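(* The rule (LC): from $(p\rightsquigarrow\phi)\wedge\Diamond p\to\psi$ infer $\Diamond\phi\to\psi$ (where $p$ is a propositional variable not occurring in $\phi,\psi$) is admissible in $\mathsf{MS^2IC}$: whenever $(p\rightsquigarrow\phi)\wedge\Diamond p\to\psi$ is a theorem of $\mathsf{MS^2IC}$ with $p$ not occurring in $\phi,\psi$, so is $\Diamond\phi\to\psi$.
   Context: Language: propositional variables, $\top,\bot$, $\neg,\wedge,\vee,\to,\leftrightarrow$, a binary connective $\rightsquigarrow$ and a unary modality $\Box$; $\Diamond\phi:=\neg\Box\neg\phi$, $[\forall]\phi:=\top\rightsquigarrow\phi$. $\mathsf{MS^2IC}$: theorems are the least set containing all instances of classical tautologies and of (A1) $(\bot\rightsquigarrow\phi)\wedge(\phi\rightsquigarrow\top)$; (A2) $((\phi\vee\psi)\rightsquigarrow\chi)\leftrightarrow((\phi\rightsquigarrow\chi)\wedge(\psi\rightsquigarrow\chi))$; (A3) $(\phi\rightsquigarrow(\psi\wedge\chi))\leftrightarrow((\phi\rightsquigarrow\psi)\wedge(\phi\rightsquigarrow\chi))$; (A4) $(\phi\rightsquigarrow\psi)\to(\phi\to\psi)$; (A5) $(\phi\rightsquigarrow\psi)\leftrightarrow(\neg\psi\rightsquigarrow\neg\phi)$; (A8) $[\forall]\phi\to[\forall][\forall]\phi$; (A9) $\neg[\forall]\phi\to[\forall]\neg[\forall]\phi$; (A10) $(\phi\rightsquigarrow\psi)\leftrightarrow[\forall](\phi\rightsquigarrow\psi)$; (A11) $[\forall]\phi\to(\neg[\forall]\phi\rightsquigarrow\bot)$;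 (K) $\Box(\phi\to\psi)\to(\Box\phi\to\Box\psi)$; (Add) $(\phi\rightsquigarrow\psi)\to(\Box\phi\rightsquigarrow\Box\psi)$; closed under modus ponens, from $\phi$ infer $[\forall]\phi$, from $\phi$ infer $\Box\phi$. *)

theory Defs
  imports Main
begin

datatype fm =
    Var nat
  | Top ("\<^bold>\<top>")
  | Bot ("\<^bold>\<bottom>")
  | Neg fm ("\<^bold>\<not> _" [70] 70)
  | Con fm fm (infixr "\<^bold>\<and>" 60)
  | Dis fm fm (infixr "\<^bold>\<or>" 55)
  | Imp fm fm (infixr "\<^bold>\<longrightarrow>" 50)
  | Iff fm fm (infix "\<^bold>\<longleftrightarrow>" 45)
  | SImp fm fm (infix "\<^bold>\<leadsto>" 65)
  | Box fm ("\<^bold>\<box> _" [70] 70)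

abbreviation Dia :: "fm \<Rightarrow> fm" ("\<^bold>\<diamond> _" [70] 70) where
  "\<^bold>\<diamond> \<phi> \<equiv> \<^bold>\<not> \<^bold>\<box> \<^bold>\<not> \<phi>"

abbreviation Univ :: "fm \<Rightarrow> fm" ("\<^bold>[\<^bold>\<forall>\<^bold>] _" [70] 70) where
  "\<^bold>[\<^bold>\<forall>\<^bold>] \<phi> \<equiv> \<^bold>\<top> \<^bold>\<leadsto> \<phi>"

primrec vars :: "fm \<Rightarrow> nat set" where
  "vars (Var p) = {p}"
| "vars \<^bold>\<top> = {}"
| "vars \<^bold>\<bottom> = {}"
| "vars (\<^bold>\<not> \<phi>) = vars \<phi>"
| "vars (\<phi> \<^bold>\<and> \<psi>) = vars \<phi> \<union> vars \<psi>"
| "vars (\<phi> \<^bold>\<or> \<psi>) = vars \<phi> \<union> vars \<psi>"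
| "vars (\<phi> \<^bold>\<longrightarrow> \<psi>) = vars \<phi> \<union> vars \<psi>"
| "vars (\<phi> \<^bold>\<longleftrightarrow> \<psi>) = vars \<phi> \<union> vars \<psi>"
| "vars (\<phi> \<^bold>\<leadsto> \<psi>) = vars \<phi> \<union> vars \<psi>"
| "vars (\<^bold>\<box> \<phi>) = vars \<phi>"

text \<open>Formulas of classical propositional logic. They serve only to express
  \<^emph>\<open>instance of a classical tautology\<close>: a tautology of this language with its
  variables replaced by arbitrary formulas of the full language.\<close>

datatype cfm =
    CVar nat
  | CTop
  | CBot
  | CNeg cfm
  | CCon cfm cfm
  | CDis cfm cfm
  | CImp cfm cfm
  | CIff cfm cfm

primrec ceval :: "(nat \<Rightarrow> bool) \<Rightarrow> cfm \<Rightarrow> bool" where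
  "ceval v (CVar n) \<longleftrightarrow> v n"
| "ceval v CTop \<longleftrightarrow> True"
| "ceval v CBot \<longleftrightarrow> False"
| "ceval v (CNeg s) \<longleftrightarrow> \<not> ceval v s"
| "ceval v (CCon s t) \<longleftrightarrow> ceval v s \<and> ceval v t"
| "ceval v (CDis s t) \<longleftrightarrow> ceval v s \<or> ceval v t"
| "ceval v (CImp s t) \<longleftrightarrow> (ceval v s \<longrightarrow> ceval v t)"
| "ceval v (CIff s t) \<longleftrightarrow> (ceval v s \<longleftrightarrow> ceval v t)"

definition tautology :: "cfm \<Rightarrow> bool" where
  "tautology t \<longleftrightarrow> (\<forall>v. ceval v t)"

primrec inst :: "(nat \<Rightarrow> fm) \<Rightarrow> cfm \<Rightarrow> fm" where
  "inst \<sigma> (CVar n) = \<sigma> n"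
| "inst \<sigma> CTop = \<^bold>\<top>"
| "inst \<sigma> CBot = \<^bold>\<bottom>"
| "inst \<sigma> (CNeg s) = \<^bold>\<not> inst \<sigma> s"
| "inst \<sigma> (CCon s t) = inst \<sigma> s \<^bold>\<and> inst \<sigma> t"
| "inst \<sigma> (CDis s t) = inst \<sigma> s \<^bold>\<or> inst \<sigma> t"
| "inst \<sigma> (CImp s t) = (inst \<sigma> s \<^bold>\<longrightarrow> inst \<sigma> t)"
| "inst \<sigma> (CIff s t) = (inst \<sigma> s \<^bold>\<longleftrightarrow> inst \<sigma> t)"

inductive MS2IC :: "fm \<Rightarrow> bool" where
  Taut: "tautology t \<Longrightarrow> MS2IC (inst \<sigma> t)"
| A1: "MS2IC ((\<^bold>\<bottom> \<^bold>\<leadsto> \<phi>) \<^bold>\<and> (\<phi> \<^bold>\<leadsto> \<^bold>\<top>))"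
| A2: "MS2IC (((\<phi> \<^bold>\<or> \<psi>) \<^bold>\<leadsto> \<chi>) \<^bold>\<longleftrightarrow> ((\<phi> \<^bold>\<leadsto> \<chi>) \<^bold>\<and> (\<psi> \<^bold>\<leadsto> \<chi>)))"
| A3: "MS2IC ((\<phi> \<^bold>\<leadsto> (\<psi> \<^bold>\<and> \<chi>)) \<^bold>\<longleftrightarrow> ((\<phi> \<^bold>\<leadsto> \<psi>) \<^bold>\<and> (\<phi> \<^bold>\<leadsto> \<chi>)))"
| A4: "MS2IC ((\<phi> \<^bold>\<leadsto> \<psi>) \<^bold>\<longrightarrow> (\<phi> \<^bold>\<longrightarrow> \<psi>))"
| A5: "MS2IC ((\<phi> \<^bold>\<leadsto> \<psi>) \<^bold>\<longleftrightarrow> ((\<^bold>\<not> \<psi>) \<^bold>\<leadsto> (\<^bold>\<not> \<phi>)))"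
| A8: "MS2IC ((\<^bold>[\<^bold>\<forall>\<^bold>] \<phi>) \<^bold>\<longrightarrow> (\<^bold>[\<^bold>\<forall>\<^bold>] \<^bold>[\<^bold>\<forall>\<^bold>] \<phi>))"
| A9: "MS2IC ((\<^bold>\<not> \<^bold>[\<^bold>\<forall>\<^bold>] \<phi>) \<^bold>\<longrightarrow> (\<^bold>[\<^bold>\<forall>\<^bold>] \<^bold>\<not> \<^bold>[\<^bold>\<forall>\<^bold>] \<phi>))"
| A10: "MS2IC ((\<phi> \<^bold>\<leadsto> \<psi>) \<^bold>\<longleftrightarrow> (\<^bold>[\<^bold>\<forall>\<^bold>] (\<phi> \<^bold>\<leadsto> \<psi>)))"
| A11: "MS2IC ((\<^bold>[\<^bold>\<forall>\<^bold>] \<phi>) \<^bold>\<longrightarrow> ((\<^bold>\<not> \<^bold>[\<^bold>\<forall>\<^bold>] \<phi>) \<^bold>\<leadsto> \<^bold>\<bottom>))"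
| K: "MS2IC ((\<^bold>\<box> (\<phi> \<^bold>\<longrightarrow> \<psi>)) \<^bold>\<longrightarrow> ((\<^bold>\<box> \<phi>) \<^bold>\<longrightarrow> (\<^bold>\<box> \<psi>)))"
| Add: "MS2IC ((\<phi> \<^bold>\<leadsto> \<psi>) \<^bold>\<longrightarrow> ((\<^bold>\<box> \<phi>) \<^bold>\<leadsto> (\<^bold>\<box> \<psi>)))"
| MP: "MS2IC \<phi> \<Longrightarrow> MS2IC (\<phi> \<^bold>\<longrightarrow> \<psi>) \<Longrightarrow> MS2IC \<psi>"
| NecUniv: "MS2IC \<phi> \<Longrightarrow> MS2IC (\<^bold>[\<^bold>\<forall>\<^bold>] \<phi>)"
| NecBox: "MS2IC \<phi> \<Longrightarrow> MS2IC (\<^bold>\<box> \<phi>)"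

end

theory Submission
  imports Defs "HOL-Library.Countable"
begin

text \<open>
  \<open>MS2IC\<close> has no congruence rule for \<open>\<^bold>\<leadsto>\<close>, so \<open>\<phi> \<^bold>\<leadsto> \<psi>\<close> is constrained only by the shape of
  \<open>\<phi>\<close> and \<open>\<psi>\<close>, as far as the axioms inspect it. This allows a translation that maps theorems to
  theorems, fixes all formulas without \<open>p\<close>, sends \<open>p\<close> to \<open>\<phi>\<close> and makes \<open>p \<^bold>\<leadsto> \<phi>\<close> provable.
  It commutes with the Boolean connectives and \<open>\<^bold>\<box>\<close>. A strict implication containing \<open>p\<close> is taken
  apart along the axioms; when none of them applies any more, it becomes \<open>\<^bold>\<top>\<close> if the corresponding
  material implication of the translations is a theorem, and \<open>\<^bold>\<bottom>\<close> otherwise. Translating the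
  premise of the rule then yields \<open>\<^bold>\<diamond> \<phi> \<^bold>\<longrightarrow> \<psi>\<close>.
\<close>

section \<open>Propositional reasoning\<close>

instance fm :: countable by countable_datatype

primrec prop_eval :: "(fm \<Rightarrow> bool) \<Rightarrow> fm \<Rightarrow> bool" where
  "prop_eval v (Var q) \<longleftrightarrow> v (Var q)"
| "prop_eval v \<^bold>\<top> \<longleftrightarrow> True"
| "prop_eval v \<^bold>\<bottom> \<longleftrightarrow> False"
| "prop_eval v (\<^bold>\<not> \<alpha>) \<longleftrightarrow> \<not> prop_eval v \<alpha>"
| "prop_eval v (\<alpha> \<^bold>\<and> \<beta>) \<longleftrightarrow> prop_eval v \<alpha> \<and> prop_eval v \<beta>"
| "prop_eval v (\<alpha> \<^bold>\<or> \<beta>) \<longleftrightarrow> prop_eval v \<alpha> \<or> prop_eval v \<beta>"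
| "prop_eval v (\<alpha> \<^bold>\<longrightarrow> \<beta>) \<longleftrightarrow> (prop_eval v \<alpha> \<longrightarrow> prop_eval v \<beta>)"
| "prop_eval v (\<alpha> \<^bold>\<longleftrightarrow> \<beta>) \<longleftrightarrow> (prop_eval v \<alpha> \<longleftrightarrow> prop_eval v \<beta>)"
| "prop_eval v (\<alpha> \<^bold>\<leadsto> \<beta>) \<longleftrightarrow> v (\<alpha> \<^bold>\<leadsto> \<beta>)"
| "prop_eval v (\<^bold>\<box> \<alpha>) \<longleftrightarrow> v (\<^bold>\<box> \<alpha>)"

text \<open>Strict implications and boxed formulas count as atoms, just as in
  \<open>prop_eval\<close>. Countability of \<open>fm\<close> supplies the variable numbers, and
  \<open>from_nat\<close> is the substitution that restores the formula.\<close>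

primrec skeleton :: "fm \<Rightarrow> cfm" where
  "skeleton (Var q) = CVar (to_nat (Var q))"
| "skeleton \<^bold>\<top> = CTop"
| "skeleton \<^bold>\<bottom> = CBot"
| "skeleton (\<^bold>\<not> \<alpha>) = CNeg (skeleton \<alpha>)"
| "skeleton (\<alpha> \<^bold>\<and> \<beta>) = CCon (skeleton \<alpha>) (skeleton \<beta>)"
| "skeleton (\<alpha> \<^bold>\<or> \<beta>) = CDis (skeleton \<alpha>) (skeleton \<beta>)"
| "skeleton (\<alpha> \<^bold>\<longrightarrow> \<beta>) = CImp (skeleton \<alpha>) (skeleton \<beta>)"
| "skeleton (\<alpha> \<^bold>\<longleftrightarrow> \<beta>) = CIff (skeleton \<alpha>) (skeleton \<beta>)"
| "skeleton (\<alpha> \<^bold>\<leadsto> \<beta>) = CVar (to_nat (\<alpha> \<^bold>\<leadsto> \<beta>))"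
| "skeleton (\<^bold>\<box> \<alpha>) = CVar (to_nat (\<^bold>\<box> \<alpha>))"

lemma inst_skeleton: "inst from_nat (skeleton \<alpha>) = \<alpha>"
  by (induction \<alpha>) simp_all

lemma ceval_skeleton: "ceval v (skeleton \<alpha>) \<longleftrightarrow> prop_eval (\<lambda>\<beta>. v (to_nat \<beta>)) \<alpha>"
  by (induction \<alpha>) simp_all

text \<open>The axiom scheme \<open>Taut\<close> in semantic form: simplification of
  \<open>prop_eval\<close> replaces explicit tautologies of type \<open>cfm\<close>. The three
  consequence lemmas below add modus ponens.\<close>

lemma MS2IC_taut:
  assumes "\<And>v. prop_eval v \<alpha>"
  shows "MS2IC \<alpha>"
  using Taut[of "skeleton \<alpha>" from_nat] assms
  by (simp add: tautology_def ceval_skeleton inst_skeleton)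

lemma MS2IC_conseq1:
  assumes "MS2IC \<alpha>" and "\<And>v. prop_eval v \<alpha> \<Longrightarrow> prop_eval v \<beta>"
  shows "MS2IC \<beta>"
  using assms(1) by (rule MP) (rule MS2IC_taut, simp add: assms(2))

lemma MS2IC_conseq2:
  assumes "MS2IC \<alpha>" and "MS2IC \<beta>"
    and "\<And>v. prop_eval v \<alpha> \<Longrightarrow> prop_eval v \<beta> \<Longrightarrow> prop_eval v \<gamma>"
  shows "MS2IC \<gamma>"
  using assms(2) by (rule MP) (rule MS2IC_conseq1[OF assms(1)], simp add: assms(3))

lemma MS2IC_conseq3:
  assumes "MS2IC \<alpha>" and "MS2IC \<beta>" and "MS2IC \<gamma>"
    and "\<And>v. prop_eval v \<alpha> \<Longrightarrow> prop_eval v \<beta> \<Longrightarrow> prop_eval v \<gamma> \<Longrightarrow> prop_eval v \<delta>"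
  shows "MS2IC \<delta>"
  using assms(3) by (rule MP) (rule MS2IC_conseq2[OF assms(1,2)], simp add: assms(4))

lemma MS2IC_SImp_Top: "MS2IC (\<alpha> \<^bold>\<leadsto> \<^bold>\<top>)"
  by (rule MS2IC_conseq1[OF A1[of \<alpha>]]) simp

lemma MS2IC_Bot_SImp: "MS2IC (\<^bold>\<bottom> \<^bold>\<leadsto> \<alpha>)"
  by (rule MS2IC_conseq1[OF A1[of \<alpha>]]) simp

section \<open>Formulas whose truth value is preserved by the modality\<close>

lemma Box_mono:
  assumes "MS2IC (\<alpha> \<^bold>\<longrightarrow> \<beta>)"
  shows "MS2IC ((\<^bold>\<box> \<alpha>) \<^bold>\<longrightarrow> (\<^bold>\<box> \<beta>))"
  using NecBox[OF assms] K by (rule MP)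

lemma Box_mono2:
  assumes "MS2IC (\<alpha> \<^bold>\<longrightarrow> (\<beta> \<^bold>\<longrightarrow> \<gamma>))"
  shows "MS2IC ((\<^bold>\<box> \<alpha>) \<^bold>\<longrightarrow> ((\<^bold>\<box> \<beta>) \<^bold>\<longrightarrow> (\<^bold>\<box> \<gamma>)))"
  by (rule MS2IC_conseq2[OF Box_mono[OF assms] K[of \<beta> \<gamma>]]) simp

text \<open>\<open>Add\<close> turns \<open>SImp Top \<alpha>\<close> into a strict implication from
  \<open>Box Top\<close> to \<open>Box \<alpha>\<close>. A4 makes it material, and necessitation
  provides \<open>Box Top\<close>.\<close>

lemma Univ_imp_Box: "MS2IC ((\<^bold>[\<^bold>\<forall>\<^bold>] \<alpha>) \<^bold>\<longrightarrow> (\<^bold>\<box> \<alpha>))"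
proof -
  have "MS2IC (\<^bold>\<box> \<^bold>\<top>)"
    by (rule NecBox) (rule MS2IC_taut, simp)
  then show ?thesis
    by (rule MS2IC_conseq3[OF _ Add[of "\<^bold>\<top>" \<alpha>] A4[of "\<^bold>\<box> \<^bold>\<top>" "\<^bold>\<box> \<alpha>"]]) simp
qed

text \<open>The positive half is what the translated A4 needs when boxes are stripped from both
  sides. The negative half makes the property closed under negation, which the
  \<open>Opposite\<close> clause requires.\<close>

definition rigid :: "fm \<Rightarrow> bool" where
  "rigid \<alpha> \<longleftrightarrow> MS2IC (\<alpha> \<^bold>\<longrightarrow> (\<^bold>\<box> \<alpha>)) \<and> MS2IC ((\<^bold>\<not> \<alpha>) \<^bold>\<longrightarrow> (\<^bold>\<box> (\<^bold>\<not> \<alpha>)))"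

lemma rigid_SImp: "rigid (\<alpha> \<^bold>\<leadsto> \<beta>)"
proof -
  let ?f = "\<alpha> \<^bold>\<leadsto> \<beta>"
  have "MS2IC (?f \<^bold>\<longrightarrow> (\<^bold>\<box> ?f))"
    by (rule MS2IC_conseq2[OF A10[of \<alpha> \<beta>] Univ_imp_Box[of ?f]]) simp
  \<comment> \<open>A9 boxes the negated universal statement, so A10 is contraposed here to be
    applied under the box.\<close>
  moreover have "MS2IC ((\<^bold>\<not> \<^bold>[\<^bold>\<forall>\<^bold>] ?f) \<^bold>\<longrightarrow> (\<^bold>\<not> ?f))"
    by (rule MS2IC_conseq1[OF A10[of \<alpha> \<beta>]]) simp
  then have "MS2IC ((\<^bold>\<box> (\<^bold>\<not> \<^bold>[\<^bold>\<forall>\<^bold>] ?f)) \<^bold>\<longrightarrow> (\<^bold>\<box> (\<^bold>\<not> ?f)))"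
    by (rule Box_mono)
  then have "MS2IC ((\<^bold>\<not> \<^bold>[\<^bold>\<forall>\<^bold>] ?f) \<^bold>\<longrightarrow> (\<^bold>\<box> (\<^bold>\<not> ?f)))"
    by (rule MS2IC_conseq3[OF _ A9[of ?f] Univ_imp_Box[of "\<^bold>\<not> \<^bold>[\<^bold>\<forall>\<^bold>] ?f"]]) simp
  then have "MS2IC ((\<^bold>\<not> ?f) \<^bold>\<longrightarrow> (\<^bold>\<box> (\<^bold>\<not> ?f)))"
    by (rule MS2IC_conseq2[OF A10[of \<alpha> \<beta>]]) simp
  ultimately show ?thesis
    unfolding rigid_def by blast
qed

lemma rigid_Top: "rigid \<^bold>\<top>"
proof -
  have "MS2IC (\<^bold>\<box> \<^bold>\<top>)"
    by (rule NecBox) (rule MS2IC_taut, simp)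
  then have "MS2IC (\<^bold>\<top> \<^bold>\<longrightarrow> (\<^bold>\<box> \<^bold>\<top>))"
    by (rule MS2IC_conseq1) simp
  then show ?thesis
    unfolding rigid_def by (auto intro: MS2IC_taut)
qed

lemma rigid_Bot: "rigid \<^bold>\<bottom>"
proof -
  have "MS2IC (\<^bold>\<box> (\<^bold>\<not> \<^bold>\<bottom>))"
    by (rule NecBox) (rule MS2IC_taut, simp)
  then have "MS2IC ((\<^bold>\<not> \<^bold>\<bottom>) \<^bold>\<longrightarrow> (\<^bold>\<box> (\<^bold>\<not> \<^bold>\<bottom>)))"
    by (rule MS2IC_conseq1) simp
  then show ?thesis
    unfolding rigid_def by (auto intro: MS2IC_taut)
qed

lemma rigid_Neg:
  assumes "rigid \<alpha>"
  shows "rigid (\<^bold>\<not> \<alpha>)"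
proof -
  \<comment> \<open>Negation exchanges the two halves of rigidity up to a double negation, which
    monotonicity introduces under the box.\<close>
  have "MS2IC ((\<^bold>\<box> \<alpha>) \<^bold>\<longrightarrow> (\<^bold>\<box> (\<^bold>\<not> (\<^bold>\<not> \<alpha>))))"
    by (rule Box_mono) (rule MS2IC_taut, simp)
  then have "MS2IC ((\<^bold>\<not> (\<^bold>\<not> \<alpha>)) \<^bold>\<longrightarrow> (\<^bold>\<box> (\<^bold>\<not> (\<^bold>\<not> \<alpha>))))"
    using assms unfolding rigid_def by (elim conjE) (erule (1) MS2IC_conseq2, simp)
  then show ?thesis
    using assms unfolding rigid_def by blast
qed

lemma rigid_Con:
  assumes "rigid \<alpha>" and "rigid \<beta>"
  shows "rigid (\<alpha> \<^bold>\<and> \<beta>)"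
proof -
  have pos: "MS2IC (\<alpha> \<^bold>\<longrightarrow> (\<^bold>\<box> \<alpha>))" "MS2IC (\<beta> \<^bold>\<longrightarrow> (\<^bold>\<box> \<beta>))"
    and neg: "MS2IC ((\<^bold>\<not> \<alpha>) \<^bold>\<longrightarrow> (\<^bold>\<box> (\<^bold>\<not> \<alpha>)))" "MS2IC ((\<^bold>\<not> \<beta>) \<^bold>\<longrightarrow> (\<^bold>\<box> (\<^bold>\<not> \<beta>)))"
    using assms unfolding rigid_def by blast+
  have "MS2IC ((\<^bold>\<box> \<alpha>) \<^bold>\<longrightarrow> ((\<^bold>\<box> \<beta>) \<^bold>\<longrightarrow> (\<^bold>\<box> (\<alpha> \<^bold>\<and> \<beta>))))"
    by (rule Box_mono2) (rule MS2IC_taut, simp)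
  then have pos_Con: "MS2IC ((\<alpha> \<^bold>\<and> \<beta>) \<^bold>\<longrightarrow> (\<^bold>\<box> (\<alpha> \<^bold>\<and> \<beta>)))"
    by (rule MS2IC_conseq3[OF pos]) simp
  \<comment> \<open>For the negative half, a false conjunction has a false conjunct, whose boxed
    negation suffices.\<close>
  have "MS2IC ((\<^bold>\<box> (\<^bold>\<not> \<alpha>)) \<^bold>\<longrightarrow> (\<^bold>\<box> (\<^bold>\<not> (\<alpha> \<^bold>\<and> \<beta>))))"
    by (rule Box_mono) (rule MS2IC_taut, simp)
  then have "MS2IC ((\<^bold>\<not> \<alpha>) \<^bold>\<longrightarrow> (\<^bold>\<box> (\<^bold>\<not> (\<alpha> \<^bold>\<and> \<beta>))))"
    by (rule MS2IC_conseq2[OF neg(1)]) simp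
  moreover have "MS2IC ((\<^bold>\<box> (\<^bold>\<not> \<beta>)) \<^bold>\<longrightarrow> (\<^bold>\<box> (\<^bold>\<not> (\<alpha> \<^bold>\<and> \<beta>))))"
    by (rule Box_mono) (rule MS2IC_taut, simp)
  then have "MS2IC ((\<^bold>\<not> \<beta>) \<^bold>\<longrightarrow> (\<^bold>\<box> (\<^bold>\<not> (\<alpha> \<^bold>\<and> \<beta>))))"
    by (rule MS2IC_conseq2[OF neg(2)]) simp
  ultimately have "MS2IC ((\<^bold>\<not> (\<alpha> \<^bold>\<and> \<beta>)) \<^bold>\<longrightarrow> (\<^bold>\<box> (\<^bold>\<not> (\<alpha> \<^bold>\<and> \<beta>))))"
    by (rule MS2IC_conseq2) auto
  with pos_Con show ?thesis
    unfolding rigid_def by blast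
qed

section \<open>The translation\<close>

text \<open>How the translation of a strict implication is obtained from smaller ones: as a
  conjunction of two, as the same value, as the negated value, or by a direct decision.\<close>

datatype reduction = Split fm fm fm fm | To fm fm | Opposite fm fm | Leaf

text \<open>The proper clauses serve, in this order, the axioms A2, A3, A5, Add, A10 (with A8), A9 and A11.\<close>

definition reduct :: "fm \<Rightarrow> fm \<Rightarrow> reduction" where
  "reduct \<alpha> \<beta> = (case (\<alpha>, \<beta>) of
      (\<alpha>1 \<^bold>\<or> \<alpha>2, _) \<Rightarrow> Split \<alpha>1 \<beta> \<alpha>2 \<beta>
    | (_, \<beta>1 \<^bold>\<and> \<beta>2) \<Rightarrow> Split \<alpha> \<beta>1 \<alpha> \<beta>2
    | (\<^bold>\<not> \<alpha>', \<^bold>\<not> \<beta>') \<Rightarrow> To \<beta>' \<alpha>'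
    | (\<^bold>\<box> \<alpha>', \<^bold>\<box> \<beta>') \<Rightarrow> To \<alpha>' \<beta>'
    | (\<^bold>\<top>, \<gamma> \<^bold>\<leadsto> \<delta>) \<Rightarrow> To \<gamma> \<delta>
    | (\<^bold>\<top>, \<^bold>\<not> (\<^bold>\<top> \<^bold>\<leadsto> \<gamma>)) \<Rightarrow> Opposite \<^bold>\<top> \<gamma>
    | (\<^bold>\<not> (\<^bold>\<top> \<^bold>\<leadsto> \<gamma>), \<^bold>\<bottom>) \<Rightarrow> To \<^bold>\<top> \<gamma>
    | _ \<Rightarrow> Leaf)"

lemma reduct_Dis: "reduct (\<alpha>1 \<^bold>\<or> \<alpha>2) \<beta> = Split \<alpha>1 \<beta> \<alpha>2 \<beta>"
  by (simp add: reduct_def)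

lemma reduct_Con:
  assumes "\<And>\<alpha>1 \<alpha>2. \<alpha> \<noteq> (\<alpha>1 \<^bold>\<or> \<alpha>2)"
  shows "reduct \<alpha> (\<beta>1 \<^bold>\<and> \<beta>2) = Split \<alpha> \<beta>1 \<alpha> \<beta>2"
  using assms by (auto simp: reduct_def split: fm.splits)

lemma reduct_Neg: "reduct (\<^bold>\<not> \<beta>) (\<^bold>\<not> \<alpha>) = To \<alpha> \<beta>"
  by (simp add: reduct_def split: fm.splits)

lemma reduct_SplitD:
  assumes "reduct \<alpha> \<beta> = Split a b c d"
  shows "\<alpha> = (a \<^bold>\<or> c) \<and> b = \<beta> \<and> d = \<beta> \<or> \<beta> = (b \<^bold>\<and> d) \<and> a = \<alpha> \<and> c = \<alpha>"
  using assms by (auto simp: reduct_def split: fm.splits)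

lemma reduct_ToD:
  assumes "reduct \<alpha> \<beta> = To a b"
  shows "\<alpha> = (\<^bold>\<not> b) \<and> \<beta> = (\<^bold>\<not> a) \<or> \<alpha> = (\<^bold>\<box> a) \<and> \<beta> = (\<^bold>\<box> b) \<or> \<alpha> = \<^bold>\<top> \<and> \<beta> = (a \<^bold>\<leadsto> b)
    \<or> \<alpha> = (\<^bold>\<not> (\<^bold>\<top> \<^bold>\<leadsto> b)) \<and> \<beta> = \<^bold>\<bottom> \<and> a = \<^bold>\<top>"
  using assms by (auto simp: reduct_def split: fm.splits)

lemma reduct_OppositeD:
  assumes "reduct \<alpha> \<beta> = Opposite a b"
  shows "\<alpha> = \<^bold>\<top> \<and> \<beta> = (\<^bold>\<not> (\<^bold>\<top> \<^bold>\<leadsto> b)) \<and> a = \<^bold>\<top>"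
  using assms by (auto simp: reduct_def split: fm.splits)

context
  fixes p :: nat and \<phi> :: fm
begin

text \<open>The freshness test precedes \<open>reduct\<close>, so that formulas without
  \<open>p\<close> stay unchanged even where a clause would apply. The recursion is mutual because a
  leaf is decided by provability between the translations of its sides.\<close>

function tr :: "fm \<Rightarrow> fm" and tr_SImp :: "fm \<Rightarrow> fm \<Rightarrow> fm" where
  "tr (Var q) = (if q = p then \<phi> else Var q)"
| "tr \<^bold>\<top> = \<^bold>\<top>"
| "tr \<^bold>\<bottom> = \<^bold>\<bottom>"
| "tr (\<^bold>\<not> \<alpha>) = \<^bold>\<not> tr \<alpha>"
| "tr (\<alpha> \<^bold>\<and> \<beta>) = tr \<alpha> \<^bold>\<and> tr \<beta>"
| "tr (\<alpha> \<^bold>\<or> \<beta>) = tr \<alpha> \<^bold>\<or> tr \<beta>"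
| "tr (\<alpha> \<^bold>\<longrightarrow> \<beta>) = (tr \<alpha> \<^bold>\<longrightarrow> tr \<beta>)"
| "tr (\<alpha> \<^bold>\<longleftrightarrow> \<beta>) = (tr \<alpha> \<^bold>\<longleftrightarrow> tr \<beta>)"
| "tr (\<alpha> \<^bold>\<leadsto> \<beta>) = tr_SImp \<alpha> \<beta>"
| "tr (\<^bold>\<box> \<alpha>) = \<^bold>\<box> tr \<alpha>"
| "tr_SImp \<alpha> \<beta> =
    (if p \<notin> vars \<alpha> \<union> vars \<beta> then \<alpha> \<^bold>\<leadsto> \<beta>
     else case reduct \<alpha> \<beta> of
       Split \<alpha>1 \<beta>1 \<alpha>2 \<beta>2 \<Rightarrow> tr_SImp \<alpha>1 \<beta>1 \<^bold>\<and> tr_SImp \<alpha>2 \<beta>2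
     | To \<alpha>' \<beta>' \<Rightarrow> tr_SImp \<alpha>' \<beta>'
     | Opposite \<alpha>' \<beta>' \<Rightarrow> \<^bold>\<not> tr_SImp \<alpha>' \<beta>'
     | Leaf \<Rightarrow> if MS2IC (tr \<alpha> \<^bold>\<longrightarrow> tr \<beta>) then \<^bold>\<top> else \<^bold>\<bottom>)"
  by pat_completeness auto
termination
  \<comment> \<open>The odd measure of \<open>tr_SImp \<alpha> \<beta>\<close> lies just below that
    of the strict implication itself and above those of \<open>tr \<alpha>\<close> and
    \<open>tr \<beta>\<close>, so calls in both directions decrease.\<close>
  by (relation "measure (case_sum (\<lambda>\<alpha>. 2 * size \<alpha>) (\<lambda>(\<alpha>, \<beta>). Suc (2 * (size \<alpha> + size \<beta>))))")
    (auto dest: reduct_SplitD reduct_ToD reduct_OppositeD)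

declare tr_SImp.simps [simp del]

lemma tr_SImp_fresh: "p \<notin> vars \<alpha> \<Longrightarrow> p \<notin> vars \<beta> \<Longrightarrow> tr_SImp \<alpha> \<beta> = (\<alpha> \<^bold>\<leadsto> \<beta>)"
  by (simp add: tr_SImp.simps)

lemma tr_fresh: "p \<notin> vars \<alpha> \<Longrightarrow> tr \<alpha> = \<alpha>"
  by (induction \<alpha>) (simp_all add: tr_SImp_fresh)

lemma tr_inst: "tr (inst \<sigma> t) = inst (tr \<circ> \<sigma>) t"
  by (induction t) simp_all

lemma tr_SImp_Split:
  assumes "p \<in> vars \<alpha> \<union> vars \<beta>" and "reduct \<alpha> \<beta> = Split a b c d"
  shows "tr_SImp \<alpha> \<beta> = tr_SImp a b \<^bold>\<and> tr_SImp c d"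
  using assms by (subst tr_SImp.simps) simp

lemma tr_SImp_To:
  assumes "p \<in> vars \<alpha> \<union> vars \<beta>" and "reduct \<alpha> \<beta> = To a b"
  shows "tr_SImp \<alpha> \<beta> = tr_SImp a b"
  using assms by (subst tr_SImp.simps) simp

lemma tr_SImp_Opposite:
  assumes "p \<in> vars \<alpha> \<union> vars \<beta>" and "reduct \<alpha> \<beta> = Opposite a b"
  shows "tr_SImp \<alpha> \<beta> = \<^bold>\<not> tr_SImp a b"
  using assms by (subst tr_SImp.simps) simp

lemma tr_SImp_Leaf:
  assumes "p \<in> vars \<alpha> \<union> vars \<beta>" and "reduct \<alpha> \<beta> = Leaf"
  shows "tr_SImp \<alpha> \<beta> = (if MS2IC (tr \<alpha> \<^bold>\<longrightarrow> tr \<beta>) then \<^bold>\<top> else \<^bold>\<bottom>)"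
  using assms by (subst tr_SImp.simps) simp

section \<open>Rigidity of translated strict implications and axiom A4\<close>

text \<open>Unfolding along \<open>reduct\<close> ends in fresh strict implications,
  \<open>Top\<close> and \<open>Bot\<close>, joined by conjunction and negation only; rigidity
  survives both.\<close>

lemma rigid_tr_SImp: "rigid (tr_SImp \<alpha> \<beta>)"
proof (induction "size \<alpha> + size \<beta>" arbitrary: \<alpha> \<beta> rule: less_induct)
  case less
  show ?case
  proof (cases "p \<in> vars \<alpha> \<union> vars \<beta>")
    case False
    then show ?thesis
      by (simp add: tr_SImp_fresh rigid_SImp)
  next
    case True
    show ?thesis
    proof (cases "reduct \<alpha> \<beta>")
      case (Split a b c d)
      with less show ?thesis
        by (auto simp: tr_SImp_Split[OF True Split] dest!: reduct_SplitD intro!: rigid_Con)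
    next
      case (To a b)
      with less show ?thesis
        by (auto simp: tr_SImp_To[OF True To] dest!: reduct_ToD)
    next
      case (Opposite a b)
      with less show ?thesis
        by (auto simp: tr_SImp_Opposite[OF True Opposite] dest!: reduct_OppositeD intro!: rigid_Neg)
    next
      case Leaf
      then show ?thesis
        by (simp add: tr_SImp_Leaf[OF True Leaf] rigid_Top rigid_Bot)
    qed
  qed
qed

text \<open>Leaves satisfy this by the choice of their value. All other cases are propositional,
  except the removal of boxes, where rigidity enters.\<close>

lemma tr_A4: "MS2IC (tr_SImp \<alpha> \<beta> \<^bold>\<longrightarrow> (tr \<alpha> \<^bold>\<longrightarrow> tr \<beta>))"
proof (induction "size \<alpha> + size \<beta>" arbitrary: \<alpha> \<beta> rule: less_induct)
  case less
  show ?case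
  proof (cases "p \<in> vars \<alpha> \<union> vars \<beta>")
    case False
    then show ?thesis
      by (simp add: tr_SImp_fresh tr_fresh A4)
  next
    case True
    show ?thesis
    proof (cases "reduct \<alpha> \<beta>")
      case (Split a b c d)
      then have "MS2IC (tr_SImp a b \<^bold>\<longrightarrow> (tr a \<^bold>\<longrightarrow> tr b))"
        and "MS2IC (tr_SImp c d \<^bold>\<longrightarrow> (tr c \<^bold>\<longrightarrow> tr d))"
        by (auto intro!: less dest!: reduct_SplitD)
      then show ?thesis
        by (rule MS2IC_conseq2)
          (use reduct_SplitD[OF Split] in \<open>auto simp: tr_SImp_Split[OF True Split]\<close>)
    next
      case (To a b)
      then have IH: "MS2IC (tr_SImp a b \<^bold>\<longrightarrow> (tr a \<^bold>\<longrightarrow> tr b))"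
        by (auto intro!: less dest!: reduct_ToD)
      show ?thesis
      proof (cases "\<alpha> = (\<^bold>\<box> a) \<and> \<beta> = (\<^bold>\<box> b)")
        case box: True
        have eq: "tr_SImp (\<^bold>\<box> a) (\<^bold>\<box> b) = tr_SImp a b"
          using tr_SImp_To[OF True To] box by simp
        \<comment> \<open>Boxing the induction hypothesis also boxes its antecedent
          \<open>tr_SImp a b\<close>; rigidity recovers the unboxed antecedent.\<close>
        have "MS2IC (tr_SImp a b \<^bold>\<longrightarrow> (\<^bold>\<box> tr_SImp a b))"
          using rigid_tr_SImp[of a b] by (simp add: rigid_def)
        then show ?thesis
          by (rule MS2IC_conseq2[OF Box_mono2[OF IH]]) (simp add: box eq)
      next
        case False
        \<comment> \<open>Contraposition uses the induction hypothesis. In the two remaining clauses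
          the value \<open>tr_SImp a b\<close> itself occurs in the translation of one side, which
          gives a tautology.\<close>
        show ?thesis
          by (rule MS2IC_conseq1[OF IH])
            (use reduct_ToD[OF To] False in \<open>auto simp: tr_SImp_To[OF True To]\<close>)
      qed
    next
      case (Opposite a b)
      \<comment> \<open>The value coincides with the translation of the right-hand side.\<close>
      from reduct_OppositeD[OF this] show ?thesis
        unfolding tr_SImp_Opposite[OF True Opposite] by (intro MS2IC_taut) auto
    next
      case Leaf
      show ?thesis
      proof (cases "MS2IC (tr \<alpha> \<^bold>\<longrightarrow> tr \<beta>)")
        case provable: True
        show ?thesis
          by (rule MS2IC_conseq1[OF provable]) simp
      next
        case False
        show ?thesis
          by (rule MS2IC_taut) (simp add: tr_SImp_Leaf[OF True Leaf] False)
      qed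
    qed
  qed
qed

section \<open>Distribution axioms A2 and A3\<close>

lemma tr_A2: "MS2IC (tr_SImp (\<alpha> \<^bold>\<or> \<beta>) \<gamma> \<^bold>\<longleftrightarrow> (tr_SImp \<alpha> \<gamma> \<^bold>\<and> tr_SImp \<beta> \<gamma>))"
proof (cases "p \<in> vars (\<alpha> \<^bold>\<or> \<beta>) \<union> vars \<gamma>")
  case True
  show ?thesis
    by (rule MS2IC_taut) (simp add: tr_SImp_Split[OF True reduct_Dis])
next
  case False
  then show ?thesis
    by (simp add: tr_SImp_fresh A2)
qed

text \<open>\<open>reduct\<close> splits a disjunction on the left before a conjunction on the
  right, so A3 holds by definition only for other left sides. For a disjunction, split all three
  strict implications by A2, use induction on the disjuncts and regroup.\<close>

lemma tr_A3: "MS2IC (tr_SImp \<alpha> (\<beta> \<^bold>\<and> \<gamma>) \<^bold>\<longleftrightarrow> (tr_SImp \<alpha> \<beta> \<^bold>\<and> tr_SImp \<alpha> \<gamma>))"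
proof (induction "size \<alpha>" arbitrary: \<alpha> rule: less_induct)
  case less
  show ?case
  proof (cases "\<exists>\<alpha>1 \<alpha>2. \<alpha> = (\<alpha>1 \<^bold>\<or> \<alpha>2)")
    case True
    then obtain \<alpha>1 \<alpha>2 where \<alpha>: "\<alpha> = (\<alpha>1 \<^bold>\<or> \<alpha>2)"
      by blast
    let ?A2 = "\<lambda>\<delta>. tr_SImp \<alpha> \<delta> \<^bold>\<longleftrightarrow> (tr_SImp \<alpha>1 \<delta> \<^bold>\<and> tr_SImp \<alpha>2 \<delta>)"
    let ?A3 = "\<lambda>\<delta>. tr_SImp \<delta> (\<beta> \<^bold>\<and> \<gamma>) \<^bold>\<longleftrightarrow> (tr_SImp \<delta> \<beta> \<^bold>\<and> tr_SImp \<delta> \<gamma>)"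
    have "MS2IC (?A2 \<beta> \<^bold>\<and> ?A2 \<gamma>)"
      unfolding \<alpha> by (rule MS2IC_conseq2[OF tr_A2 tr_A2]) simp
    moreover have "MS2IC (?A3 \<alpha>1 \<^bold>\<and> ?A3 \<alpha>2)"
      by (rule MS2IC_conseq2[OF less less]) (auto simp: \<alpha>)
    ultimately show ?thesis
      by (rule MS2IC_conseq3[OF tr_A2[of \<alpha>1 \<alpha>2 "\<beta> \<^bold>\<and> \<gamma>"]]) (auto simp: \<alpha>)
  next
    case no_Dis: False
    then have red: "reduct \<alpha> (\<beta> \<^bold>\<and> \<gamma>) = Split \<alpha> \<beta> \<alpha> \<gamma>"
      by (intro reduct_Con) blast
    show ?thesis
    proof (cases "p \<in> vars \<alpha> \<union> vars (\<beta> \<^bold>\<and> \<gamma>)")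
      case True
      show ?thesis
        by (rule MS2IC_taut) (simp add: tr_SImp_Split[OF True red])
    next
      case False
      then show ?thesis
        by (simp add: tr_SImp_fresh A3)
    qed
  qed
qed

section \<open>Strict implications with provable translations\<close>

lemma tr_SImp_Con:
  assumes "MS2IC (tr_SImp \<alpha> \<beta>)" and "MS2IC (tr_SImp \<alpha> \<gamma>)"
  shows "MS2IC (tr_SImp \<alpha> (\<beta> \<^bold>\<and> \<gamma>))"
  by (rule MS2IC_conseq3[OF assms tr_A3[of \<alpha> \<beta> \<gamma>]]) simp

lemma tr_SImp_LeafI:
  assumes "p \<in> vars \<alpha> \<union> vars \<beta>" and "reduct \<alpha> \<beta> = Leaf" and "MS2IC (tr \<alpha> \<^bold>\<longrightarrow> tr \<beta>)"
  shows "MS2IC (tr_SImp \<alpha> \<beta>)"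
  using assms by (simp add: tr_SImp_Leaf) (rule MS2IC_taut, simp)

lemma tr_SImp_fresh_or_LeafI:
  assumes "p \<notin> vars \<alpha> \<union> vars \<beta> \<Longrightarrow> MS2IC (\<alpha> \<^bold>\<leadsto> \<beta>)"
    and "reduct \<alpha> \<beta> = Leaf" and "MS2IC (tr \<alpha> \<^bold>\<longrightarrow> tr \<beta>)"
  shows "MS2IC (tr_SImp \<alpha> \<beta>)"
  using assms by (cases "p \<in> vars \<alpha> \<union> vars \<beta>") (auto simp: tr_SImp_fresh intro: tr_SImp_LeafI)

text \<open>With a variable on the left, \<open>reduct\<close> can only split conjunctions on the
  right. Each remaining leaf becomes \<open>Top\<close> by the assumption, since
  \<open>tr (Var p)\<close> is \<phi>.\<close>

lemma tr_SImp_Var: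
  assumes "MS2IC (\<phi> \<^bold>\<longrightarrow> tr \<beta>)"
  shows "MS2IC (tr_SImp (Var p) \<beta>)"
  using assms
proof (induction \<beta>)
  case (Con \<beta>1 \<beta>2)
  have "MS2IC (\<phi> \<^bold>\<longrightarrow> tr \<beta>1)" "MS2IC (\<phi> \<^bold>\<longrightarrow> tr \<beta>2)"
    using Con.prems by (rule MS2IC_conseq1, simp)+
  with Con.IH show ?case
    by (blast intro: tr_SImp_Con)
qed (auto intro!: tr_SImp_LeafI simp: reduct_def)

text \<open>Again only conjunctions on the right are split; the rest is either fresh, hence an
  instance of A1, or a leaf with a tautological material implication. \<open>tr_SImp_Top\<close> is
  dual, with disjunctions on the left.\<close>

lemma tr_SImp_Bot: "MS2IC (tr_SImp \<^bold>\<bottom> \<beta>)"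
proof (induction \<beta>)
  case (Con \<beta>1 \<beta>2)
  then show ?case
    by (rule tr_SImp_Con)
qed (rule tr_SImp_fresh_or_LeafI, rule MS2IC_Bot_SImp, simp add: reduct_def, rule MS2IC_taut, simp)+

lemma tr_SImp_Top: "MS2IC (tr_SImp \<alpha> \<^bold>\<top>)"
proof (induction \<alpha>)
  case (Dis \<alpha>1 \<alpha>2)
  then show ?case
    by (rule MS2IC_conseq3[OF _ _ tr_A2[of \<alpha>1 \<alpha>2 "\<^bold>\<top>"]]) simp
qed (rule tr_SImp_fresh_or_LeafI, rule MS2IC_SImp_Top, simp add: reduct_def split: fm.splits,
  rule MS2IC_taut, simp)+

text \<open>With \<open>Top\<close> on the left, the clauses for A9 and A10 reproduce
  \<open>tr \<theta>\<close>, conjunctions split into provable conjuncts, and a leaf is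
  \<open>Top\<close> because \<open>tr \<theta>\<close> is a theorem. Fresh formulas use the
  original rule.\<close>

lemma tr_NecUniv:
  assumes "MS2IC (tr \<theta>)"
  shows "MS2IC (tr_SImp \<^bold>\<top> \<theta>)"
  using assms
proof (induction \<theta>)
  case (Con \<theta>1 \<theta>2)
  have "MS2IC (tr \<theta>1)" "MS2IC (tr \<theta>2)"
    using Con.prems by (rule MS2IC_conseq1, simp)+
  with Con.IH show ?case
    by (blast intro: tr_SImp_Con)
next
  case (SImp \<theta>1 \<theta>2)
  then show ?case
    using tr_SImp_To[of "\<^bold>\<top>" "\<theta>1 \<^bold>\<leadsto> \<theta>2" \<theta>1 \<theta>2]
    by (cases "p \<in> vars \<theta>1 \<union> vars \<theta>2") (auto simp: tr_SImp_fresh reduct_def intro: NecUniv)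
next
  case (Neg \<theta>)
  show ?case
  proof (cases "p \<in> vars \<theta>")
    case False
    with Neg.prems show ?thesis
      by (simp add: tr_SImp_fresh tr_fresh NecUniv)
  next
    case True
    show ?thesis
    proof (cases "\<exists>\<gamma>. \<theta> = (\<^bold>\<top> \<^bold>\<leadsto> \<gamma>)")
      case univ: True
      then obtain \<gamma> where "\<theta> = (\<^bold>\<top> \<^bold>\<leadsto> \<gamma>)"
        by blast
      with Neg.prems True tr_SImp_Opposite[of "\<^bold>\<top>" "\<^bold>\<not> \<theta>" "\<^bold>\<top>" \<gamma>] show ?thesis
        by (simp add: reduct_def)
    next
      case False
      then have "reduct \<^bold>\<top> (\<^bold>\<not> \<theta>) = Leaf"
        by (auto simp: reduct_def split: fm.splits)
      moreover have "MS2IC (tr \<^bold>\<top> \<^bold>\<longrightarrow> tr (\<^bold>\<not> \<theta>))"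
        using Neg.prems by (rule MS2IC_conseq1) simp
      ultimately show ?thesis
        using True by (intro tr_SImp_LeafI) simp_all
    qed
  qed
qed (rule tr_SImp_fresh_or_LeafI, simp add: NecUniv tr_fresh tr_SImp_fresh, simp add: reduct_def,
  erule MS2IC_conseq1, simp split del: if_split)+

section \<open>Soundness of the translation\<close>

text \<open>For A5, A8 to A11 and \<open>Add\<close>, an instance containing \<open>p\<close>
  becomes a tautology, because the matching clause of \<open>reduct\<close> identifies the values
  involved; an instance without \<open>p\<close> is left as it is.\<close>

lemma tr_sound: "MS2IC \<chi> \<Longrightarrow> MS2IC (tr \<chi>)"
proof (induction rule: MS2IC.induct)
  case (Taut t \<sigma>)
  then show ?case
    by (simp add: tr_inst MS2IC.Taut)
next
  case (A1 \<alpha>)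
  show ?case
    by (rule MS2IC_conseq2[OF tr_SImp_Bot[of \<alpha>] tr_SImp_Top[of \<alpha>]]) simp
next
  case (A2 \<alpha> \<beta> \<gamma>)
  show ?case
    by (simp add: tr_A2)
next
  case (A3 \<alpha> \<beta> \<gamma>)
  show ?case
    by (simp add: tr_A3)
next
  case (A4 \<alpha> \<beta>)
  show ?case
    by (simp add: tr_A4)
next
  case (A5 \<alpha> \<beta>)
  show ?case
  proof (cases "p \<in> vars \<alpha> \<union> vars \<beta>")
    case True
    then have "tr_SImp (\<^bold>\<not> \<beta>) (\<^bold>\<not> \<alpha>) = tr_SImp \<alpha> \<beta>"
      by (intro tr_SImp_To) (auto simp: reduct_Neg)
    then show ?thesis
      by (intro MS2IC_taut) simp
  next
    case False
    then show ?thesis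
      by (simp add: tr_SImp_fresh MS2IC.A5)
  qed
next
  case (A8 \<alpha>)
  show ?case
  proof (cases "p \<in> vars \<alpha>")
    case True
    then have "tr_SImp \<^bold>\<top> (\<^bold>\<top> \<^bold>\<leadsto> \<alpha>) = tr_SImp \<^bold>\<top> \<alpha>"
      by (intro tr_SImp_To) (auto simp: reduct_def)
    then show ?thesis
      by (intro MS2IC_taut) simp
  next
    case False
    then show ?thesis
      by (simp add: tr_SImp_fresh MS2IC.A8)
  qed
next
  case (A9 \<alpha>)
  show ?case
  proof (cases "p \<in> vars \<alpha>")
    case True
    then have "tr_SImp \<^bold>\<top> (\<^bold>\<not> (\<^bold>\<top> \<^bold>\<leadsto> \<alpha>)) = \<^bold>\<not> tr_SImp \<^bold>\<top> \<alpha>"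
      by (intro tr_SImp_Opposite) (auto simp: reduct_def)
    then show ?thesis
      by (intro MS2IC_taut) simp
  next
    case False
    then show ?thesis
      by (simp add: tr_SImp_fresh MS2IC.A9)
  qed
next
  case (A10 \<alpha> \<beta>)
  show ?case
  proof (cases "p \<in> vars \<alpha> \<union> vars \<beta>")
    case True
    then have "tr_SImp \<^bold>\<top> (\<alpha> \<^bold>\<leadsto> \<beta>) = tr_SImp \<alpha> \<beta>"
      by (intro tr_SImp_To) (auto simp: reduct_def)
    then show ?thesis
      by (intro MS2IC_taut) simp
  next
    case False
    then show ?thesis
      by (simp add: tr_SImp_fresh MS2IC.A10)
  qed
next
  case (A11 \<alpha>)
  show ?case
  proof (cases "p \<in> vars \<alpha>")
    case True
    then have "tr_SImp (\<^bold>\<not> (\<^bold>\<top> \<^bold>\<leadsto> \<alpha>)) \<^bold>\<bottom> = tr_SImp \<^bold>\<top> \<alpha>"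
      by (intro tr_SImp_To) (auto simp: reduct_def)
    then show ?thesis
      by (intro MS2IC_taut) simp
  next
    case False
    then show ?thesis
      by (simp add: tr_SImp_fresh MS2IC.A11)
  qed
next
  case (K \<alpha> \<beta>)
  show ?case
    by (simp add: MS2IC.K)
next
  case (Add \<alpha> \<beta>)
  show ?case
  proof (cases "p \<in> vars \<alpha> \<union> vars \<beta>")
    case True
    then have "tr_SImp (\<^bold>\<box> \<alpha>) (\<^bold>\<box> \<beta>) = tr_SImp \<alpha> \<beta>"
      by (intro tr_SImp_To) (auto simp: reduct_def)
    then show ?thesis
      by (intro MS2IC_taut) simp
  next
    case False
    then show ?thesis
      by (simp add: tr_SImp_fresh MS2IC.Add)
  qed
next
  case (MP \<alpha> \<beta>)
  show ?case
    by (rule MS2IC.MP[OF MP.IH(1)]) (use MP.IH(2) in simp)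
next
  case (NecUniv \<alpha>)
  then show ?case
    by (simp add: tr_NecUniv)
next
  case (NecBox \<alpha>)
  then show ?case
    by (simp add: MS2IC.NecBox)
qed

end

section \<open>Admissibility of the rule (LC)\<close>

theorem theorem4p21:
  fixes p :: nat and \<phi> \<psi> :: fm
  assumes "p \<notin> vars \<phi>" and "p \<notin> vars \<psi>"
    and "MS2IC (((Var p \<^bold>\<leadsto> \<phi>) \<^bold>\<and> (\<^bold>\<diamond> (Var p))) \<^bold>\<longrightarrow> \<psi>)"
  shows "MS2IC ((\<^bold>\<diamond> \<phi>) \<^bold>\<longrightarrow> \<psi>)"
proof -
  \<comment> \<open>Outside the context, the first two arguments are the variable and its
    replacement. Freshness leaves \<psi> unchanged and turns the diamond of \<open>p\<close> into
    that of \<phi>.\<close>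
  have "MS2IC ((tr_SImp p \<phi> (Var p) \<phi> \<^bold>\<and> (\<^bold>\<diamond> \<phi>)) \<^bold>\<longrightarrow> \<psi>)"
    using tr_sound[OF assms(3), of p \<phi>] by (simp add: tr_fresh assms(2))
  \<comment> \<open>As \<open>p\<close> does not occur in \<phi>, \<open>tr\<close> fixes \<phi>,
    and the required material implication is from \<phi> to itself.\<close>
  moreover have "MS2IC (tr_SImp p \<phi> (Var p) \<phi>)"
    by (rule tr_SImp_Var) (simp add: tr_fresh assms(1) MS2IC_taut)
  ultimately show ?thesis
    by (rule MS2IC_conseq2) simp
qed

end
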